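(* Let $(K,d,m)$ be a measure metric group. Then for every $0<\epsilon\le1$ and every $r>0$, $$\epsilon^2\cdot\alpha_{(K,d,m)}(\epsilon)\le10\cdot\Omega_{(K,d,m)}(r,r/2).$$
   Context: A measure metric group $(K,d,m)$ consists of a compact metrizable group $K$, a compatible right-invariant metric $d$ on $K$ (so $d(xg,yg)=d(x,y)$), and the Haar probability measure $m$ of $K$. The concentration function is $\alpha_{(K,d,m)}(\epsilon):=1-\inf\{m(B_d(A,\epsilon)): A\subseteq K \text{ Borel},\ m(A)\ge1/2\}$ for $\epsilon>0$, where $B_d(A,\epsilon)$ is the $\epsilon$-neighborhood of $A$ in $(K,d)$. Write $e_K$ for the identity and $B_d(r):=\{h\in K: d(e_K,h)\le r\}$. Let $\mathcal{D}(K,m):=\{\phi\in L^1(K,m):\phi\ge 0,\ \int_K\phi\,dm=1\}$; for $\phi\in\mathcal{D}(K,m)$ let $\phi m$ be the probability measure with density $\phi$ with respect to $m$, and for $h\in K$ put $(h.\phi)(g):=\phi(h^{-1}g)$. Put $\mathbf{V}_m(\phi,\phi'):=\frac12\int_K|\phi-\phi'|\,dm$, and for Borel probability measures $\alpha,\beta$ on $K$ put $\mathbf{W}_d(\alpha,\beta):=\sup_f\left|\int f\,d\alpha-\int f\,d\beta\right|$, the supremum over all real functions $f$ on $K$ that are $1$-Lipschitz with respect to $d$. A $\mathcal{D}(K,m)$-valued measurable kernel is a family $\Phi=\{\phi_z:z\in Z\}\subset\mathcal{D}(K,m)$ indexed by a probability space $(Z,\zeta)$ and measurable (i.e. $(z,g)\mapsto\phi_z(g)$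 is measurable). Put $$\mathbf{v}_m(\Phi,r):=\sup_{h\in B_d(r)}\int_Z\mathbf{V}_m(h.\phi_z,\phi_z)\,d\zeta(z),\qquad \mathbf{w}_d(\Phi):=\int_Z\mathbf{W}_d(\phi_z m,m)\,d\zeta(z),$$ and, for $r,\epsilon>0$, the Wasserstein modulus is $\Omega_{(K,d,m)}(r,\epsilon):=\sup\{\mathbf{w}_d(\Phi):\mathbf{v}_m(\Phi,r)\le\epsilon\}$, the supremum over all $\mathcal{D}(K,m)$-valued measurable kernels $\Phi$ (over all probability spaces). *)

theory Defs
  imports "HOL-Probability.Probability" "HOL-Algebra.Group"
begin

text \<open>The topology of the group is the metric topology of \<open>d\<close>, which is how compatibility of \<open>d\<close> is
  expressed. The Haar probability measure is the left-invariant Borel probability measure;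
  on a compact metrizable group regularity and right-invariance are automatic.\<close>

locale measure_metric_group =
  fixes K :: "('a, 'b) monoid_scheme" (structure)
    and d :: "'a \<Rightarrow> 'a \<Rightarrow> real"
    and m :: "'a measure"
  assumes group: "Group.group K"
    and metric: "Metric_space (carrier K) d"
    and compact: "compact_space (Metric_space.mtopology (carrier K) d)"
    and continuous_mult:
      "continuous_map
         (prod_topology (Metric_space.mtopology (carrier K) d) (Metric_space.mtopology (carrier K) d))
         (Metric_space.mtopology (carrier K) d) (\<lambda>(x, y). x \<otimes> y)"
    and continuous_inv:
      "continuous_map (Metric_space.mtopology (carrier K) d) (Metric_space.mtopology (carrier K) d)
         (\<lambda>x. inv x)"
    and right_invariant:
      "\<And>x y g. x \<in> carrier K \<Longrightarrow> y \<in> carrier K \<Longrightarrow> g \<in> carrier K \<Longrightarrow> d (x \<otimes> g) (y \<otimes> g) = d x y"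
    and prob_space_haar: "prob_space m"
    and space_haar: "space m = carrier K"
    and sets_haar:
      "sets m = sigma_sets (carrier K) {U. openin (Metric_space.mtopology (carrier K) d) U}"
    and left_invariant_haar:
      "\<And>g A. g \<in> carrier K \<Longrightarrow> A \<in> sets m \<Longrightarrow> measure m ((\<lambda>x. g \<otimes> x) ` A) = measure m A"

definition neighborhood :: "('a, 'b) monoid_scheme \<Rightarrow> ('a \<Rightarrow> 'a \<Rightarrow> real) \<Rightarrow> 'a set \<Rightarrow> real \<Rightarrow> 'a set"
  where "neighborhood K d A \<epsilon> = (\<Union>a\<in>A. Metric_space.mball (carrier K) d a \<epsilon>)"

definition concentration_function ::
    "('a, 'b) monoid_scheme \<Rightarrow> ('a \<Rightarrow> 'a \<Rightarrow> real) \<Rightarrow> 'a measure \<Rightarrow> real \<Rightarrow> real"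
  where "concentration_function K d m \<epsilon> =
    1 - Inf {measure m (neighborhood K d A \<epsilon>) | A. A \<in> sets m \<and> measure m A \<ge> 1/2}"

text \<open>Elements of \<open>L\<^sup>1\<close> are represented by integrable functions, so \<open>\<phi> \<ge> 0\<close> is an a.e. statement.\<close>

definition densities :: "'a measure \<Rightarrow> ('a \<Rightarrow> real) set"
  where "densities m = {\<phi>. integrable m \<phi> \<and> (AE g in m. 0 \<le> \<phi> g) \<and> (\<integral>g. \<phi> g \<partial>m) = 1}"

definition translate :: "('a, 'b) monoid_scheme \<Rightarrow> 'a \<Rightarrow> ('a \<Rightarrow> real) \<Rightarrow> 'a \<Rightarrow> real"
  where "translate K h \<phi> = (\<lambda>g. \<phi> (inv\<^bsub>K\<^esub> h \<otimes>\<^bsub>K\<^esub> g))"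

definition variation_dist :: "'a measure \<Rightarrow> ('a \<Rightarrow> real) \<Rightarrow> ('a \<Rightarrow> real) \<Rightarrow> real"
  where "variation_dist m \<phi> \<psi> = 1/2 * (\<integral>g. \<bar>\<phi> g - \<psi> g\<bar> \<partial>m)"

definition lipschitz_1 :: "('a, 'b) monoid_scheme \<Rightarrow> ('a \<Rightarrow> 'a \<Rightarrow> real) \<Rightarrow> ('a \<Rightarrow> real) set"
  where "lipschitz_1 K d = {f. \<forall>x\<in>carrier K. \<forall>y\<in>carrier K. \<bar>f x - f y\<bar> \<le> d x y}"

definition wasserstein_dist ::
    "('a, 'b) monoid_scheme \<Rightarrow> ('a \<Rightarrow> 'a \<Rightarrow> real) \<Rightarrow> 'a measure \<Rightarrow> 'a measure \<Rightarrow> real"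
  where "wasserstein_dist K d \<alpha> \<beta> = (SUP f\<in>lipschitz_1 K d. \<bar>(\<integral>x. f x \<partial>\<alpha>) - (\<integral>x. f x \<partial>\<beta>)\<bar>)"

definition density_kernel :: "'a measure \<Rightarrow> 'z measure \<Rightarrow> ('z \<Rightarrow> 'a \<Rightarrow> real) \<Rightarrow> bool"
  where "density_kernel m Z \<Phi> \<longleftrightarrow>
    prob_space Z \<and> (\<forall>z\<in>space Z. \<Phi> z \<in> densities m) \<and>
    (\<lambda>(z, g). \<Phi> z g) \<in> borel_measurable (Z \<Otimes>\<^sub>M m)"

definition kernel_v ::
    "('a, 'b) monoid_scheme \<Rightarrow> ('a \<Rightarrow> 'a \<Rightarrow> real) \<Rightarrow> 'a measure \<Rightarrow> 'z measure \<Rightarrow> ('z \<Rightarrow> 'a \<Rightarrow> real) \<Rightarrow> real \<Rightarrow> real"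
  where "kernel_v K d m Z \<Phi> r =
    (SUP h\<in>Metric_space.mcball (carrier K) d \<one>\<^bsub>K\<^esub> r.
       \<integral>z. variation_dist m (translate K h (\<Phi> z)) (\<Phi> z) \<partial>Z)"

definition kernel_w ::
    "('a, 'b) monoid_scheme \<Rightarrow> ('a \<Rightarrow> 'a \<Rightarrow> real) \<Rightarrow> 'a measure \<Rightarrow> 'z measure \<Rightarrow> ('z \<Rightarrow> 'a \<Rightarrow> real) \<Rightarrow> real"
  where "kernel_w K d m Z \<Phi> =
    (\<integral>z. wasserstein_dist K d (density m (\<lambda>g. ennreal (\<Phi> z g))) m \<partial>Z)"

text \<open>HOL cannot quantify over all types within a term, so the supremum over all probability
  spaces is taken over probability spaces (with an arbitrary \<open>\<sigma>\<close>-algebra) on subsets of the reals.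
  The lemma \<open>kernel_w_le_wasserstein_modulus\<close> below shows that this loses nothing: kernels
  over probability spaces on any type whatsoever are dominated by this supremum.
  All real suprema here are over nonempty bounded sets: \<open>d\<close> is bounded and variation distances
  of densities are at most \<open>1\<close>.\<close>

definition wasserstein_modulus ::
    "('a, 'b) monoid_scheme \<Rightarrow> ('a \<Rightarrow> 'a \<Rightarrow> real) \<Rightarrow> 'a measure \<Rightarrow> real \<Rightarrow> real \<Rightarrow> real"
  where "wasserstein_modulus K d m r \<epsilon> =
    Sup {kernel_w K d m Z \<Phi> | (Z :: real measure) \<Phi>.
           density_kernel m Z \<Phi> \<and> kernel_v K d m Z \<Phi> r \<le> \<epsilon>}"

lemma ex_inj_nat_set_real: "\<exists>b :: nat set \<Rightarrow> real. inj b"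
proof -
  define c :: "nat set \<Rightarrow> nat \<Rightarrow> real" where "c S n = indicator S n * (1/3)^n" for S n
  have sc: "summable (c S)" for S
    by (rule summable_comparison_test'[of "\<lambda>n. (1/3::real)^n" 0])
       (auto simp: c_def indicator_def summable_geometric)
  have less: "suminf (c T) < suminf (c S)"
    if n: "n \<in> S" "n \<notin> T" and eq: "\<And>k. k < n \<Longrightarrow> k \<in> S \<longleftrightarrow> k \<in> T" for S T n
  proof -
    have s1: "suminf (c S) = (\<Sum>i. c S (i + Suc n)) + (\<Sum>i<Suc n. c S i)" for S
      by (rule suminf_split_initial_segment[OF sc])
    have init: "(\<Sum>i<n. c S i) = (\<Sum>i<n. c T i)"
      by (rule sum.cong) (auto simp: c_def indicator_def eq)
    have sg: "summable (\<lambda>i. (1/3::real)^(i + Suc n))"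
      using summable_ignore_initial_segment[of "\<lambda>i. (1/3::real)^i" "Suc n"]
      by (simp add: summable_geometric)
    have "(\<Sum>i. c T (i + Suc n)) \<le> (\<Sum>i. (1/3::real)^(i + Suc n))"
      by (rule suminf_le) (use sg summable_ignore_initial_segment[OF sc, of T "Suc n"] in
          \<open>auto simp: c_def indicator_def\<close>)
    also have "\<dots> = (1/3)^Suc n * (\<Sum>i. (1/3::real)^i)"
      by (subst suminf_mult[symmetric]) (auto simp: summable_geometric power_add mult_ac)
    also have "\<dots> = (1/3)^n / 2"
      by (simp add: suminf_geometric)
    finally have tailT: "(\<Sum>i. c T (i + Suc n)) \<le> (1/3)^n / 2" .
    have tailS: "0 \<le> (\<Sum>i. c S (i + Suc n))"
      by (rule suminf_nonneg) (use summable_ignore_initial_segment[OF sc, of S "Suc n"] in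
          \<open>auto simp: c_def\<close>)
    have "c S n = (1/3)^n" "c T n = 0"
      using n by (auto simp: c_def)
    moreover have "(0::real) < (1/3)^n" by simp
    ultimately show ?thesis
      using s1[of S] s1[of T] init tailT tailS unfolding sum.lessThan_Suc by linarith
  qed
  have "inj (\<lambda>S. suminf (c S))"
  proof (rule injI, rule ccontr)
    fix S T assume eq: "suminf (c S) = suminf (c T)" and "S \<noteq> T"
    then have ex: "\<exists>n. (n \<in> S) \<noteq> (n \<in> T)" by auto
    define n where "n = (LEAST n. (n \<in> S) \<noteq> (n \<in> T))"
    have n: "(n \<in> S) \<noteq> (n \<in> T)"
      unfolding n_def by (rule LeastI_ex[OF ex])
    have lt: "(k \<in> S) = (k \<in> T)" if "k < n" for k
      using not_less_Least[of k "\<lambda>n. (n \<in> S) \<noteq> (n \<in> T)"] that by (auto simp: n_def)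
    show False
      using less[of n S T] less[of n T S] n lt eq by auto
  qed
  then show ?thesis by blast
qed

lemma sets_pair_countably_generated:
  assumes "A \<in> sets (Z \<Otimes>\<^sub>M M)"
  shows "\<exists>E. range E \<subseteq> sets Z \<and>
           A \<in> sigma_sets (space Z \<times> space M) {E (n::nat) \<times> C | n C. C \<in> sets M}"
proof -
  from assms have "A \<in> sigma_sets (space Z \<times> space M) {a \<times> b | a b. a \<in> sets Z \<and> b \<in> sets M}"
    by (simp add: sets_pair_measure)
  then show ?thesis
  proof induction
    case (Basic A)
    then obtain a b where ab: "A = a \<times> b" "a \<in> sets Z" "b \<in> sets M" by auto
    show ?case
      by (rule exI[of _ "\<lambda>_. a"]) (use ab in \<open>auto intro!: sigma_sets.Basic\<close>)
  next
    case Empty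
    then show ?case
      by (intro exI[of _ "\<lambda>_. {}"]) (auto intro: sigma_sets.Empty)
  next
    case (Compl A)
    from Compl.IH obtain E where "range E \<subseteq> sets Z"
      "A \<in> sigma_sets (space Z \<times> space M) {E (n::nat) \<times> C | n C. C \<in> sets M}"
      by (elim exE conjE)
    then show ?case
      by (blast intro: exI[of _ E] sigma_sets.Compl[of A])
  next
    case (Union A)
    have "\<forall>i. \<exists>E. range E \<subseteq> sets Z \<and>
        A i \<in> sigma_sets (space Z \<times> space M) {E (n::nat) \<times> C | n C. C \<in> sets M}"
      using Union.IH by (rule allI)
    from choice[OF this] obtain E where E: "\<And>i. range (E i) \<subseteq> sets Z"
      "\<And>i. A i \<in> sigma_sets (space Z \<times> space M) {E i (n::nat) \<times> C | n C. C \<in> sets M}"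
      by auto
    define F where "F n = (case prod_decode n of (i, j) \<Rightarrow> E i j)" for n
    have F: "F (prod_encode (i, j)) = E i j" for i j by (simp add: F_def)
    have "A i \<in> sigma_sets (space Z \<times> space M) {F n \<times> C | n C. C \<in> sets M}" for i
    proof -
      have "{E i (n::nat) \<times> C | n C. C \<in> sets M} \<subseteq> {F n \<times> C | n C. C \<in> sets M}"
        using F by blast
      from sigma_sets_mono'[OF this] show ?thesis using E(2)[of i] by blast
    qed
    then have "(\<Union>i. A i) \<in> sigma_sets (space Z \<times> space M) {F n \<times> C | n C. C \<in> sets M}"
      by (rule sigma_sets.Union)
    moreover have "range F \<subseteq> sets Z"
      using E(1) by (auto simp: F_def split: prod.splits)
    ultimately show ?case by blast
  qed
qed

lemma measurable_pair_factor_real: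
  fixes f :: "'z \<times> 'a \<Rightarrow> real"
  assumes f: "f \<in> borel_measurable (Z \<Otimes>\<^sub>M M)"
  shows "\<exists>(h :: 'z \<Rightarrow> real) N F. h \<in> measurable Z N \<and> space N = h ` space Z \<and>
           (\<forall>B\<subseteq>space N. B \<in> sets N \<longleftrightarrow> h -` B \<inter> space Z \<in> sets Z) \<and>
           F \<in> borel_measurable (N \<Otimes>\<^sub>M M) \<and> (\<forall>z\<in>space Z. \<forall>g\<in>space M. f (z, g) = F (h z, g))"
proof -
  define A where "A q = {x \<in> space (Z \<Otimes>\<^sub>M M). f x < real_of_rat q}" for q
  have "A q \<in> sets (Z \<Otimes>\<^sub>M M)" for q
    unfolding A_def using f by measurable
  then have "\<forall>q. \<exists>E. range E \<subseteq> sets Z \<and>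
           A q \<in> sigma_sets (space Z \<times> space M) {E (n::nat) \<times> C | n C. C \<in> sets M}"
    by (intro allI sets_pair_countably_generated)
  from choice[OF this] obtain E where E: "\<And>q. range (E q) \<subseteq> sets Z"
      "\<And>q. A q \<in> sigma_sets (space Z \<times> space M) {E q (n::nat) \<times> C | n C. C \<in> sets M}"
    by auto
  define G where "G n = (case prod_decode n of (i, j) \<Rightarrow> E (from_nat i) j)" for n
  have EG: "\<exists>k. E q n = G k" for q n
    by (rule exI[of _ "prod_encode (to_nat q, n)"]) (simp add: G_def)
  have G: "G n \<in> sets Z" for n
    using E(1) by (auto simp: G_def split: prod.splits)
  obtain b :: "nat set \<Rightarrow> real" where b: "inj b"
    using ex_inj_nat_set_real by blast
  define h where "h z = b {n. z \<in> G n}" for z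
  have hG: "z' \<in> G n" if "h z = h z'" "z \<in> G n" for z z' n
    using that b by (auto simp: h_def inj_eq)
  define T where "T = {B. B \<subseteq> h ` space Z \<and> h -` B \<inter> space Z \<in> sets Z}"
  define N where "N = sigma (h ` space Z) T"
  have T: "sigma_algebra (h ` space Z) T"
  proof (rule sigma_algebra_iff2[THEN iffD2], safe)
    show "{} \<in> T" by (auto simp: T_def)
  next
    fix x s assume "s \<in> T" "x \<in> s" then show "x \<in> h ` space Z" by (auto simp: T_def)
  next
    fix s assume s: "s \<in> T"
    have "h -` (h ` space Z - s) \<inter> space Z = space Z - (h -` s \<inter> space Z)" by auto
    then show "h ` space Z - s \<in> T" using s by (auto simp: T_def)
  next
    fix B :: "nat \<Rightarrow> real set" assume B: "range B \<subseteq> T"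
    have "h -` B i \<inter> space Z \<in> sets Z" for i
      using B by (auto simp: T_def)
    then have "(\<Union>i. h -` B i \<inter> space Z) \<in> sets Z" by blast
    moreover have "h -` (\<Union>i. B i) \<inter> space Z = (\<Union>i. h -` B i \<inter> space Z)" by auto
    ultimately have "h -` (\<Union>i. B i) \<inter> space Z \<in> sets Z" by simp
    then show "(\<Union>i. B i) \<in> T" using B by (auto simp: T_def)
  qed
  have spN: "space N = h ` space Z"
    unfolding N_def by (rule space_measure_of) (auto simp: T_def)
  have seN: "sets N = T"
    unfolding N_def
    by (subst sets_measure_of) (auto simp: T_def[symmetric] sigma_algebra.sigma_sets_eq[OF T], auto simp: T_def)
  have hN: "h \<in> measurable Z N"
    by (rule measurableI) (auto simp: spN seN T_def)
  have transfer: "\<exists>B\<in>sets (N \<Otimes>\<^sub>M M). \<forall>z\<in>space Z. \<forall>g\<in>space M. (z, g) \<in> S \<longleftrightarrow> (h z, g) \<in> B"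
    if "S \<in> sigma_sets (space Z \<times> space M) {G (n::nat) \<times> C | n C. C \<in> sets M}" for S
    using that
  proof induction
    case (Basic S)
    then obtain n C where S: "S = G n \<times> C" "C \<in> sets M" by auto
    have "h -` (h ` G n) \<inter> space Z = G n"
    proof (intro equalityI subsetI)
      fix z assume "z \<in> h -` (h ` G n) \<inter> space Z"
      then obtain z' where "z' \<in> G n" "h z' = h z" by (metis IntD1 vimageE imageE)
      then show "z \<in> G n" by (rule hG[rotated])
    next
      fix z assume "z \<in> G n"
      then show "z \<in> h -` (h ` G n) \<inter> space Z"
        using sets.sets_into_space[OF G[of n]] by blast
    qed
    then have "h ` G n \<in> sets N"
      using G[of n] sets.sets_into_space[OF G[of n]] by (auto simp: seN T_def)
    then have "h ` G n \<times> C \<in> sets (N \<Otimes>\<^sub>M M)" using S(2) by (rule pair_measureI)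
    then show ?case
    proof (rule bexI[rotated], intro ballI)
      fix z g
      have "h z \<in> h ` G n \<longleftrightarrow> z \<in> G n"
        by (metis hG imageE imageI)
      then show "(z, g) \<in> S \<longleftrightarrow> (h z, g) \<in> h ` G n \<times> C"
        by (simp add: S(1))
    qed
  next
    case Empty
    then show ?case by (intro bexI[of _ "{}"]) auto
  next
    case (Compl S)
    then obtain B where B: "B \<in> sets (N \<Otimes>\<^sub>M M)"
      "\<forall>z\<in>space Z. \<forall>g\<in>space M. (z, g) \<in> S \<longleftrightarrow> (h z, g) \<in> B" by auto
    show ?case
    proof (rule bexI)
      show "space (N \<Otimes>\<^sub>M M) - B \<in> sets (N \<Otimes>\<^sub>M M)"
        using B(1) by (rule sets.compl_sets)
      show "\<forall>z\<in>space Z. \<forall>g\<in>space M. (z, g) \<in> space Z \<times> space M - S \<longleftrightarrow>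
          (h z, g) \<in> space (N \<Otimes>\<^sub>M M) - B"
        using B(2) by (simp add: space_pair_measure spN)
    qed
  next
    case (Union S)
    from Union.IH have "\<forall>i. \<exists>B. B \<in> sets (N \<Otimes>\<^sub>M M) \<and>
      (\<forall>z\<in>space Z. \<forall>g\<in>space M. (z, g) \<in> S i \<longleftrightarrow> (h z, g) \<in> B)"
      unfolding Bex_def by (rule allI)
    from choice[OF this] obtain B where B': "\<forall>i. B i \<in> sets (N \<Otimes>\<^sub>M M) \<and>
      (\<forall>z\<in>space Z. \<forall>g\<in>space M. (z, g) \<in> S i \<longleftrightarrow> (h z, g) \<in> B i)" ..
    show ?case
    proof (rule bexI)
      show "(\<Union>i. B i) \<in> sets (N \<Otimes>\<^sub>M M)"
        using B' by (intro sets.countable_UN) blast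
      show "\<forall>z\<in>space Z. \<forall>g\<in>space M. (z, g) \<in> (\<Union>i. S i) \<longleftrightarrow> (h z, g) \<in> (\<Union>i. B i)"
        using B' by simp
    qed
  qed
  have "\<exists>B\<in>sets (N \<Otimes>\<^sub>M M). \<forall>z\<in>space Z. \<forall>g\<in>space M. (z, g) \<in> A q \<longleftrightarrow> (h z, g) \<in> B" for q
  proof (rule transfer)
    have "{E q (n::nat) \<times> C | n C. C \<in> sets M} \<subseteq> {G n \<times> C | n C. C \<in> sets M}"
      using EG[of q] by blast
    from sigma_sets_mono'[OF this]
    show "A q \<in> sigma_sets (space Z \<times> space M) {G n \<times> C | n C. C \<in> sets M}"
      using E(2)[of q] by blast
  qed
  then have "\<forall>q. \<exists>B. B \<in> sets (N \<Otimes>\<^sub>M M) \<and>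
      (\<forall>z\<in>space Z. \<forall>g\<in>space M. (z, g) \<in> A q \<longleftrightarrow> (h z, g) \<in> B)"
    unfolding Bex_def by (rule allI)
  from choice[OF this] obtain B where B': "\<forall>q. B q \<in> sets (N \<Otimes>\<^sub>M M) \<and>
      (\<forall>z\<in>space Z. \<forall>g\<in>space M. (z, g) \<in> A q \<longleftrightarrow> (h z, g) \<in> B q)" ..
  have B: "B q \<in> sets (N \<Otimes>\<^sub>M M)"
    "z \<in> space Z \<Longrightarrow> g \<in> space M \<Longrightarrow> (z, g) \<in> A q \<longleftrightarrow> (h z, g) \<in> B q" for q z g
    using B' by blast+
  define F where "F x = f (inv_into (space Z) h (fst x), snd x)" for x
  have feq: "f (z, g) = f (z', g)"
    if "z \<in> space Z" "z' \<in> space Z" "g \<in> space M" "h z = h z'" for z z' g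
  proof -
    have *: "f (z, g) < real_of_rat q \<longleftrightarrow> f (z', g) < real_of_rat q" for q
      using B(2)[of z g q] B(2)[of z' g q] that by (auto simp: A_def space_pair_measure)
    show ?thesis
    proof (rule ccontr)
      assume "f (z, g) \<noteq> f (z', g)"
      then consider "f (z, g) < f (z', g)" | "f (z', g) < f (z, g)" by linarith
      then show False
      proof cases
        case 1
        then obtain q where "f (z, g) < real_of_rat q" "real_of_rat q < f (z', g)"
          using of_rat_dense by blast
        then show False using *[of q] by simp
      next
        case 2
        then obtain q where "f (z', g) < real_of_rat q" "real_of_rat q < f (z, g)"
          using of_rat_dense by blast
        then show False using *[of q] by simp
      qed
    qed
  qed
  have fF: "f (z, g) = F (h z, g)" if "z \<in> space Z" "g \<in> space M" for z g
    unfolding F_def fst_conv snd_conv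
    by (rule feq) (use that in \<open>auto simp: inv_into_into f_inv_into_f\<close>)
  have lev: "{x \<in> space (N \<Otimes>\<^sub>M M). F x < real_of_rat q} = B q" for q
  proof -
    have "B q \<subseteq> space (N \<Otimes>\<^sub>M M)" using B(1) by (rule sets.sets_into_space)
    moreover have "(h z, g) \<in> B q \<longleftrightarrow> F (h z, g) < real_of_rat q"
      if "z \<in> space Z" "g \<in> space M" for z g
      using B(2)[OF that, of q] fF[OF that] that by (auto simp: A_def space_pair_measure)
    ultimately show ?thesis by (auto simp: space_pair_measure spN)
  qed
  have "F \<in> borel_measurable (N \<Otimes>\<^sub>M M)"
    unfolding borel_measurable_iff_less
  proof
    fix a
    have "{x \<in> space (N \<Otimes>\<^sub>M M). F x < a} =
      (\<Union>q\<in>{q. real_of_rat q < a}. {x \<in> space (N \<Otimes>\<^sub>M M). F x < real_of_rat q})"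
      by (auto dest: of_rat_dense)
    also have "\<dots> \<in> sets (N \<Otimes>\<^sub>M M)"
      unfolding lev using B(1) by (intro sets.countable_UN') auto
    finally show "{x \<in> space (N \<Otimes>\<^sub>M M). F x < a} \<in> sets (N \<Otimes>\<^sub>M M)" .
  qed
  then show ?thesis
    using hN spN fF by (intro exI[of _ h] exI[of _ N] exI[of _ F]) (auto simp: seN T_def)
qed

lemma integral_distr_final:
  fixes u :: "real \<Rightarrow> real"
  assumes h: "h \<in> measurable Z N" and sp: "space N = h ` space Z"
    and fin: "\<forall>B\<subseteq>space N. B \<in> sets N \<longleftrightarrow> h -` B \<inter> space Z \<in> sets Z"
  shows "(\<integral>x. u x \<partial>distr Z N h) = (\<integral>z. u (h z) \<partial>Z)"
proof (cases "u \<in> borel_measurable N")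
  case True
  then show ?thesis by (rule integral_distr[OF h])
next
  case False
  have "(\<lambda>z. u (h z)) \<notin> borel_measurable Z"
  proof
    assume m: "(\<lambda>z. u (h z)) \<in> borel_measurable Z"
    have "u \<in> borel_measurable N"
    proof (rule measurableI)
      fix C :: "real set" assume "C \<in> sets borel"
      then have "(\<lambda>z. u (h z)) -` C \<inter> space Z \<in> sets Z" by (rule measurable_sets[OF m])
      moreover have "h -` (u -` C \<inter> space N) \<inter> space Z = (\<lambda>z. u (h z)) -` C \<inter> space Z"
        by (auto simp: sp)
      ultimately show "u -` C \<inter> space N \<in> sets N" using fin by (metis inf_le2)
    qed simp
    with False show False ..
  qed
  then have "\<not> integrable Z (\<lambda>z. u (h z))" by auto
  moreover have "\<not> integrable (distr Z N h) u" using False by auto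
  ultimately show ?thesis by (simp add: not_integrable_integral_eq)
qed

lemma kernel_reindex_real:
  fixes Z :: "'z measure"
  assumes K: "measure_metric_group K d m" and \<Phi>: "density_kernel m Z \<Phi>"
  shows "\<exists>(N :: real measure) \<Psi>. density_kernel m N \<Psi> \<and>
           kernel_v K d m N \<Psi> r = kernel_v K d m Z \<Phi> r \<and> kernel_w K d m N \<Psi> = kernel_w K d m Z \<Phi>"
proof -
  interpret K: measure_metric_group K d m by (rule K)
  interpret Group.group K by (rule K.group)
  note sp = K.space_haar
  interpret Z: prob_space Z using \<Phi> by (simp add: density_kernel_def)
  from \<Phi> have "(\<lambda>(z, g). \<Phi> z g) \<in> borel_measurable (Z \<Otimes>\<^sub>M m)" by (simp add: density_kernel_def)
  from measurable_pair_factor_real[OF this]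
  obtain h :: "'z \<Rightarrow> real" and N F where h: "h \<in> measurable Z N" and spN: "space N = h ` space Z"
    and fin: "\<forall>B\<subseteq>space N. B \<in> sets N \<longleftrightarrow> h -` B \<inter> space Z \<in> sets Z"
    and F: "F \<in> borel_measurable (N \<Otimes>\<^sub>M m)"
    and eq': "\<forall>z\<in>space Z. \<forall>g\<in>space m. (case (z, g) of (z, g) \<Rightarrow> \<Phi> z g) = F (h z, g)"
    by (elim exE conjE)
  have eq: "\<Phi> z g = F (h z, g)" if "z \<in> space Z" "g \<in> space m" for z g
    using eq' that by simp
  define \<Psi> where "\<Psi> x g = F (x, g)" for x g
  define N' where "N' = distr Z N h"
  have int: "(\<integral>x. u x \<partial>N') = (\<integral>z. u (h z) \<partial>Z)" for u :: "real \<Rightarrow> real"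
    unfolding N'_def by (rule integral_distr_final[OF h spN fin])
  have dens: "\<Psi> (h z) \<in> densities m" if "z \<in> space Z" for z
  proof -
    from \<Phi> that have "\<Phi> z \<in> densities m" by (simp add: density_kernel_def)
    moreover have "integrable m (\<Psi> (h z)) \<longleftrightarrow> integrable m (\<Phi> z)"
      by (rule Bochner_Integration.integrable_cong) (auto simp: \<Psi>_def eq[OF that])
    moreover have "(\<integral>g. \<Psi> (h z) g \<partial>m) = (\<integral>g. \<Phi> z g \<partial>m)"
      by (rule Bochner_Integration.integral_cong) (auto simp: \<Psi>_def eq[OF that])
    moreover have "(AE g in m. 0 \<le> \<Psi> (h z) g) \<longleftrightarrow> (AE g in m. 0 \<le> \<Phi> z g)"
      by (rule AE_cong) (auto simp: \<Psi>_def eq[OF that])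
    ultimately show ?thesis by (simp add: densities_def)
  qed
  have ker: "density_kernel m N' \<Psi>"
    unfolding density_kernel_def
  proof (intro conjI)
    show "prob_space N'" unfolding N'_def by (rule Z.prob_space_distr[OF h])
    show "\<forall>z\<in>space N'. \<Psi> z \<in> densities m"
      using dens by (auto simp: N'_def spN)
    have "sets (N' \<Otimes>\<^sub>M m) = sets (N \<Otimes>\<^sub>M m)"
      by (rule sets_pair_measure_cong) (auto simp: N'_def)
    moreover have "(\<lambda>(z, g). \<Psi> z g) = F" by (auto simp: \<Psi>_def)
    ultimately show "(\<lambda>(z, g). \<Psi> z g) \<in> borel_measurable (N' \<Otimes>\<^sub>M m)"
      using F by (simp cong: measurable_cong_sets)
  qed
  have v: "(\<integral>x. variation_dist m (translate K k (\<Psi> x)) (\<Psi> x) \<partial>N') =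
      (\<integral>z. variation_dist m (translate K k (\<Phi> z)) (\<Phi> z) \<partial>Z)"
    if k: "k \<in> carrier K" for k
    unfolding int
  proof (rule Bochner_Integration.integral_cong)
    fix z assume z: "z \<in> space Z"
    have "(\<integral>g. \<bar>translate K k (\<Psi> (h z)) g - \<Psi> (h z) g\<bar> \<partial>m) =
      (\<integral>g. \<bar>translate K k (\<Phi> z) g - \<Phi> z g\<bar> \<partial>m)"
      by (rule Bochner_Integration.integral_cong)
         (use k in \<open>auto simp: translate_def \<Psi>_def eq[OF z] sp\<close>)
    then show "variation_dist m (translate K k (\<Psi> (h z))) (\<Psi> (h z)) =
        variation_dist m (translate K k (\<Phi> z)) (\<Phi> z)"
      by (simp add: variation_dist_def)
  qed simp
  have V: "kernel_v K d m N' \<Psi> r = kernel_v K d m Z \<Phi> r"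
    unfolding kernel_v_def
    by (rule SUP_cong) (use v Metric_space.mcball_subset_mspace[OF K.metric] in auto)
  have W: "kernel_w K d m N' \<Psi> = kernel_w K d m Z \<Phi>"
    unfolding kernel_w_def int
  proof (rule Bochner_Integration.integral_cong)
    fix z assume z: "z \<in> space Z"
    have "density m (\<lambda>g. ennreal (\<Psi> (h z) g)) = density m (\<lambda>g. ennreal (\<Phi> z g))"
    proof (rule density_cong)
      have "\<Psi> (h z) \<in> borel_measurable m" "\<Phi> z \<in> borel_measurable m"
        using dens[OF z] \<Phi> z by (auto simp: densities_def density_kernel_def)
      then show "(\<lambda>g. ennreal (\<Psi> (h z) g)) \<in> borel_measurable m"
        "(\<lambda>g. ennreal (\<Phi> z g)) \<in> borel_measurable m" by measurable
      show "AE g in m. ennreal (\<Psi> (h z) g) = ennreal (\<Phi> z g)"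
        by (rule AE_I2) (auto simp: \<Psi>_def eq[OF z])
    qed
    then show "wasserstein_dist K d (density m (\<lambda>g. ennreal (\<Psi> (h z) g))) m =
       wasserstein_dist K d (density m (\<lambda>g. ennreal (\<Phi> z g))) m" by simp
  qed simp
  from ker V W show ?thesis by blast
qed

lemma wasserstein_dist_bounded:
  assumes K: "measure_metric_group K d m"
  shows "\<exists>D. \<forall>\<phi>\<in>densities m. wasserstein_dist K d (density m (\<lambda>g. ennreal (\<phi> g))) m \<le> D"
proof -
  interpret K: measure_metric_group K d m by (rule K)
  interpret Group.group K by (rule K.group)
  interpret met: Metric_space "carrier K" d by (rule K.metric)
  interpret m: prob_space m by (rule K.prob_space_haar)
  have "met.mbounded (carrier K)"
    using met.compactin_imp_mbounded[of "carrier K"] K.compact by (simp add: compact_space_def)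
  then obtain D where D: "\<And>x y. x \<in> carrier K \<Longrightarrow> y \<in> carrier K \<Longrightarrow> d x y \<le> D"
    by (auto simp: met.mbounded_alt)
  have lipD: "\<bar>f x - f y\<bar> \<le> d x y"
    if "f \<in> lipschitz_1 K d" "x \<in> carrier K" "y \<in> carrier K" for f x y
    using that by (auto simp: lipschitz_1_def)
  have bd: "\<bar>(\<integral>x. f x \<partial>P) - f \<one>\<^bsub>K\<^esub>\<bar> \<le> D"
    if f: "f \<in> lipschitz_1 K d" and P: "prob_space P" "space P = carrier K" and i: "integrable P f"
    for f P
  proof -
    interpret P: prob_space P by (rule P(1))
    have *: "\<bar>f x - f \<one>\<^bsub>K\<^esub>\<bar> \<le> D" if "x \<in> carrier K" for x
      using lipD[OF f that one_closed] D[OF that one_closed] by linarith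
    have "(\<integral>x. f x \<partial>P) \<le> f \<one>\<^bsub>K\<^esub> + D"
      by (rule P.integral_le_const[OF i], rule AE_I2) (use * P(2) in \<open>simp add: abs_le_iff algebra_simps\<close>)
    moreover have "f \<one>\<^bsub>K\<^esub> - D \<le> (\<integral>x. f x \<partial>P)"
      by (rule P.integral_ge_const[OF i], rule AE_I2) (use * P(2) in \<open>simp add: abs_le_iff algebra_simps\<close>)
    ultimately show ?thesis by linarith
  qed
  have "wasserstein_dist K d (density m (\<lambda>g. ennreal (\<phi> g))) m \<le> 2 * D"
    if \<phi>: "\<phi> \<in> densities m" for \<phi>
    unfolding wasserstein_dist_def
  proof (rule cSUP_least)
    have "(\<lambda>_. 0) \<in> lipschitz_1 K d" by (auto simp: lipschitz_1_def)
    then show "lipschitz_1 K d \<noteq> {}" by blast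
  next
    fix f assume f: "f \<in> lipschitz_1 K d"
    let ?P = "density m (\<lambda>g. ennreal (\<phi> g))"
    have \<phi>m: "\<phi> \<in> borel_measurable m" "AE g in m. 0 \<le> \<phi> g" "integrable m \<phi>" "(\<integral>g. \<phi> g \<partial>m) = 1"
      using \<phi> by (auto simp: densities_def)
    have P: "prob_space ?P"
    proof
      have "emeasure ?P (space ?P) = (\<integral>\<^sup>+ g. ennreal (\<phi> g) \<partial>m)"
        using \<phi>m(1) by (simp add: emeasure_density cong: nn_integral_cong)
      also have "\<dots> = 1" using nn_integral_eq_integral[OF \<phi>m(3,2)] \<phi>m(4) by simp
      finally show "emeasure ?P (space ?P) = 1" .
    qed
    have D0: "0 \<le> D" using D[OF one_closed one_closed] by simp
    show "\<bar>(\<integral>x. f x \<partial>?P) - (\<integral>x. f x \<partial>m)\<bar> \<le> 2 * D"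
    proof (cases "f \<in> borel_measurable m")
      case True
      have int: "integrable Q f" if Q: "prob_space Q" "space Q = carrier K" "sets Q = sets m" for Q
      proof -
        interpret Q: prob_space Q by (rule Q(1))
        have "\<bar>f x\<bar> \<le> \<bar>f \<one>\<^bsub>K\<^esub>\<bar> + D" if "x \<in> carrier K" for x
          using lipD[OF f that one_closed] D[OF that one_closed] by linarith
        moreover have "f \<in> borel_measurable Q"
          using True Q(3) by (simp cong: measurable_cong_sets)
        ultimately show ?thesis
          by (intro Q.integrable_const_bound[where B = "\<bar>f \<one>\<^bsub>K\<^esub>\<bar> + D"] AE_I2) (auto simp: Q(2))
      qed
      have "\<bar>(\<integral>x. f x \<partial>?P) - f \<one>\<^bsub>K\<^esub>\<bar> \<le> D"
        by (rule bd[OF f P _ int[OF P]]) (simp_all add: K.space_haar)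
      moreover have "\<bar>(\<integral>x. f x \<partial>m) - f \<one>\<^bsub>K\<^esub>\<bar> \<le> D"
        by (rule bd[OF f K.prob_space_haar _ int[OF K.prob_space_haar]]) (simp_all add: K.space_haar)
      ultimately show ?thesis by linarith
    next
      case False
      then have "\<not> integrable ?P f" "\<not> integrable m f" by auto
      then show ?thesis using D0 by (simp add: not_integrable_integral_eq)
    qed
  qed
  then show ?thesis by blast
qed

lemma kernel_w_bounded:
  assumes K: "measure_metric_group K d m"
  shows "\<exists>D. \<forall>(Z :: 'z measure) \<Phi>. density_kernel m Z \<Phi> \<longrightarrow> kernel_w K d m Z \<Phi> \<le> D"
proof -
  obtain D where D: "\<And>\<phi>. \<phi> \<in> densities m \<Longrightarrow>
      wasserstein_dist K d (density m (\<lambda>g. ennreal (\<phi> g))) m \<le> D"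
    using wasserstein_dist_bounded[OF K] by blast
  have "kernel_w K d m Z \<Phi> \<le> max 0 D" if k: "density_kernel m Z \<Phi>" for Z :: "'z measure" and \<Phi>
  proof -
    interpret Z: prob_space Z using k by (simp add: density_kernel_def)
    let ?u = "\<lambda>z. wasserstein_dist K d (density m (\<lambda>g. ennreal (\<Phi> z g))) m"
    show ?thesis
    proof (cases "integrable Z ?u")
      case True
      have "(\<integral>z. ?u z \<partial>Z) \<le> max 0 D"
        by (rule Z.integral_le_const[OF True], rule AE_I2)
           (use D k in \<open>auto simp: density_kernel_def le_max_iff_disj\<close>)
      then show ?thesis by (simp add: kernel_w_def)
    qed (simp add: kernel_w_def not_integrable_integral_eq)
  qed
  then show ?thesis by blast
qed

lemma kernel_w_le_wasserstein_modulus: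
  fixes Z :: "'z measure"
  assumes K: "measure_metric_group K d m"
    and \<Phi>: "density_kernel m Z \<Phi>" and v: "kernel_v K d m Z \<Phi> r \<le> \<epsilon>"
  shows "kernel_w K d m Z \<Phi> \<le> wasserstein_modulus K d m r \<epsilon>"
proof -
  obtain N :: "real measure" and \<Psi> where N: "density_kernel m N \<Psi>"
    "kernel_v K d m N \<Psi> r = kernel_v K d m Z \<Phi> r" "kernel_w K d m N \<Psi> = kernel_w K d m Z \<Phi>"
    using kernel_reindex_real[OF K \<Phi>] by blast
  obtain D where "\<And>(Z :: real measure) \<Phi>. density_kernel m Z \<Phi> \<Longrightarrow> kernel_w K d m Z \<Phi> \<le> D"
    using kernel_w_bounded[OF K] by blast
  then have "bdd_above {kernel_w K d m Z \<Phi> | (Z :: real measure) \<Phi>.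
           density_kernel m Z \<Phi> \<and> kernel_v K d m Z \<Phi> r \<le> \<epsilon>}"
    by (auto intro!: bdd_aboveI[of _ D])
  moreover have "kernel_w K d m Z \<Phi> \<in> {kernel_w K d m Z \<Phi> | (Z :: real measure) \<Phi>.
           density_kernel m Z \<Phi> \<and> kernel_v K d m Z \<Phi> r \<le> \<epsilon>}"
    using N v by (metis (mono_tags, lifting) mem_Collect_eq)
  ultimately show ?thesis
    unfolding wasserstein_modulus_def by (rule cSup_upper[rotated])
qed

end

theory Submission
  imports Defs
begin

text \<open>Right-invariance gives \<open>d (h\<inverse>g) g = d e h\<close>, so a \<open>1\<close>-Lipschitz density moves by at most
  \<open>r/2\<close> in variation under \<open>B\<^sub>d(r)\<close>, and the kernel consisting of this density alone shows that
  its Wasserstein distance to \<open>m\<close> is at most \<open>\<Omega>(r, r/2)\<close>. For \<open>m(A) \<ge> 1/2\<close> take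
  \<open>f = min \<epsilon> (dist(\<cdot>, A))\<close> with mean \<open>c\<close> and the density \<open>1 + f - c\<close>. Testing against \<open>f\<close> itself
  bounds the variance of \<open>f\<close> by \<open>\<Omega>(r, r/2)\<close>, while \<open>f = 0\<close> on \<open>A\<close> and \<open>f = \<epsilon>\<close> off the
  \<open>\<epsilon>\<close>-neighbourhood of \<open>A\<close> bound it below.\<close>

context measure_metric_group
begin

interpretation Group.group K by (rule group)
interpretation met: Metric_space "carrier K" d by (rule metric)
interpretation m: prob_space m by (rule prob_space_haar)

section \<open>Integrals of Lipschitz functions and the Wasserstein distance\<close>

lemma lipschitz_1D:
  assumes "f \<in> lipschitz_1 K d" "x \<in> carrier K" "y \<in> carrier K"
  shows "\<bar>f x - f y\<bar> \<le> d x y"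
  using assms by (auto simp: lipschitz_1_def)

lemma openin_imp_sets: "openin met.mtopology U \<Longrightarrow> U \<in> sets m"
  by (simp add: sets_haar sigma_sets.Basic)

text \<open>The sigma-algebra of \<open>m\<close> is generated by the metric topology, so it
  suffices that sublevel sets are open: around \<open>x\<close> the ball of radius
  \<open>a - f x\<close> stays inside.\<close>

lemma lipschitz_1_borel_measurable:
  assumes f: "f \<in> lipschitz_1 K d"
  shows "f \<in> borel_measurable m"
proof (subst borel_measurable_iff_less, rule allI)
  fix a
  have "openin met.mtopology {x \<in> space m. f x < a}"
    unfolding met.openin_mtopology space_haar
  proof (intro conjI ballI allI impI)
    fix x assume x: "x \<in> {x \<in> carrier K. f x < a}"
    have "met.mball x (a - f x) \<subseteq> {x \<in> carrier K. f x < a}"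
    proof
      fix y assume y: "y \<in> met.mball x (a - f x)"
      then have "\<bar>f x - f y\<bar> \<le> d x y" by (intro lipschitz_1D[OF f]) auto
      with y show "y \<in> {x \<in> carrier K. f x < a}" by auto
    qed
    then show "\<exists>r>0. met.mball x r \<subseteq> {x \<in> carrier K. f x < a}"
      using x by (intro exI[of _ "a - f x"]) auto
  qed auto
  then show "{x \<in> space m. f x < a} \<in> sets m" by (rule openin_imp_sets)
qed

lemma metric_bounded:
  obtains D where "\<And>x y. x \<in> carrier K \<Longrightarrow> y \<in> carrier K \<Longrightarrow> d x y \<le> D"
proof -
  have "met.mbounded (carrier K)"
    using met.compactin_imp_mbounded[of "carrier K"] compact by (simp add: compact_space_def)
  then show ?thesis using that by (auto simp: met.mbounded_alt)
qed

lemma lipschitz_1_bounded: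
  assumes f: "f \<in> lipschitz_1 K d"
  obtains B where "\<And>x. x \<in> carrier K \<Longrightarrow> \<bar>f x\<bar> \<le> B"
proof -
  obtain D where D: "\<And>x y. x \<in> carrier K \<Longrightarrow> y \<in> carrier K \<Longrightarrow> d x y \<le> D"
    using metric_bounded by blast
  have "\<bar>f x\<bar> \<le> \<bar>f \<one>\<bar> + D" if "x \<in> carrier K" for x
    using lipschitz_1D[OF f that one_closed] D[OF that one_closed] by linarith
  then show ?thesis by (rule that)
qed

lemma lipschitz_1_integrable: "f \<in> lipschitz_1 K d \<Longrightarrow> integrable m f"
  by (metis AE_I2 lipschitz_1_borel_measurable lipschitz_1_bounded m.integrable_const_bound
      real_norm_def space_haar)

lemma lipschitz_1_mult_integrable:
  assumes f: "f \<in> lipschitz_1 K d" and \<phi>: "integrable m \<phi>"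
  shows "integrable m (\<lambda>x. \<phi> x * f x)"
proof -
  obtain B where B: "\<And>x. x \<in> carrier K \<Longrightarrow> \<bar>f x\<bar> \<le> B"
    using lipschitz_1_bounded[OF f] by blast
  show ?thesis
  proof (rule Bochner_Integration.integrable_bound)
    show "integrable m (\<lambda>x. B * \<phi> x)" using \<phi> by simp
    show "(\<lambda>x. \<phi> x * f x) \<in> borel_measurable m"
      using \<phi> lipschitz_1_borel_measurable[OF f] by (intro borel_measurable_times) auto
    show "AE x in m. norm (\<phi> x * f x) \<le> norm (B * \<phi> x)"
    proof (rule AE_I2)
      fix x assume "x \<in> space m"
      then have "\<bar>f x\<bar> \<le> \<bar>B\<bar>" using B[of x] by (simp add: space_haar)
      from mult_right_mono[OF this, of "\<bar>\<phi> x\<bar>"]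
      show "norm (\<phi> x * f x) \<le> norm (B * \<phi> x)" by (simp add: abs_mult mult.commute)
    qed
  qed
qed

lemma integral_density_lipschitz_1:
  assumes f: "f \<in> lipschitz_1 K d" and \<phi>: "\<phi> \<in> densities m"
  shows "(\<integral>x. f x \<partial>density m (\<lambda>g. ennreal (\<phi> g))) = (\<integral>x. \<phi> x * f x \<partial>m)"
  using \<phi> lipschitz_1_borel_measurable[OF f]
  by (subst integral_density) (auto simp: densities_def)

text \<open>A single test function is dominated by the real-valued supremum only once the family is
  bounded above; most of the argument supplies a bound that is uniform over
  \<open>lipschitz_1 K d\<close>.\<close>

lemma lipschitz_1_le_wasserstein_dist:
  assumes f: "f \<in> lipschitz_1 K d" and \<phi>: "\<phi> \<in> densities m"
  shows "\<bar>(\<integral>x. \<phi> x * f x \<partial>m) - (\<integral>x. f x \<partial>m)\<bar>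
    \<le> wasserstein_dist K d (density m (\<lambda>g. ennreal (\<phi> g))) m"
proof -
  obtain D where D: "\<And>x y. x \<in> carrier K \<Longrightarrow> y \<in> carrier K \<Longrightarrow> d x y \<le> D"
    using metric_bounded by blast
  have \<phi>i: "integrable m \<phi>" "(\<integral>x. \<phi> x \<partial>m) = 1" using \<phi> by (auto simp: densities_def)
  let ?F = "\<lambda>u. \<bar>(\<integral>x. u x \<partial>density m (\<lambda>g. ennreal (\<phi> g))) - (\<integral>x. u x \<partial>m)\<bar>"
  have "?F u \<le> (\<integral>x. D * \<bar>\<phi> x - 1\<bar> \<partial>m)" if u: "u \<in> lipschitz_1 K d" for u
  proof -
    have ui: "integrable m u" "integrable m (\<lambda>x. \<phi> x * u x)"
      using u \<phi>i lipschitz_1_integrable lipschitz_1_mult_integrable by auto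
    \<comment> \<open>The subtracted term integrates to 0 because \<open>\<phi>\<close> has mean 1.
      Centring \<open>u\<close> at the identity makes the diameter bound \<open>D\<close> available,
      whatever the additive constant of \<open>u\<close>.\<close>
    have "(\<integral>x. \<phi> x * u x \<partial>m) - (\<integral>x. u x \<partial>m) = (\<integral>x. (\<phi> x * u x - u x) - u \<one> * (\<phi> x - 1) \<partial>m)"
      using ui \<phi>i by (simp add: m.prob_space)
    also have "\<dots> = (\<integral>x. (u x - u \<one>) * (\<phi> x - 1) \<partial>m)"
      by (simp add: algebra_simps)
    also have "\<bar>\<dots>\<bar> \<le> (\<integral>x. \<bar>(u x - u \<one>) * (\<phi> x - 1)\<bar> \<partial>m)"
      by (rule integral_abs_bound)
    also have "\<dots> \<le> (\<integral>x. D * \<bar>\<phi> x - 1\<bar> \<partial>m)"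
    proof (rule integral_mono')
      show "integrable m (\<lambda>x. D * \<bar>\<phi> x - 1\<bar>)" using \<phi>i by simp
    next
      fix x assume "x \<in> space m"
      then have "\<bar>u x - u \<one>\<bar> \<le> D"
        using lipschitz_1D[OF u, of x \<one>] D[of x \<one>] by (force simp: space_haar)
      then show "\<bar>(u x - u \<one>) * (\<phi> x - 1)\<bar> \<le> D * \<bar>\<phi> x - 1\<bar>" "0 \<le> D * \<bar>\<phi> x - 1\<bar>"
        by (auto simp: abs_mult intro!: mult_right_mono)
    qed
    finally show ?thesis by (simp add: integral_density_lipschitz_1[OF u \<phi>])
  qed
  then have "bdd_above (?F ` lipschitz_1 K d)" by (rule bdd_aboveI2)
  from cSUP_upper[OF f this] show ?thesis
    by (simp add: wasserstein_dist_def integral_density_lipschitz_1[OF f \<phi>])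
qed

section \<open>Lipschitz densities and the Wasserstein modulus\<close>

lemma variation_dist_translate_le:
  assumes \<phi>: "\<phi> \<in> lipschitz_1 K d" and h: "h \<in> carrier K"
  shows "variation_dist m (translate K h \<phi>) \<phi> \<le> d \<one> h / 2"
proof -
  have "(\<integral>g. \<bar>translate K h \<phi> g - \<phi> g\<bar> \<partial>m) \<le> (\<integral>g. d \<one> h \<partial>m)"
  \<comment> \<open>Only the constant majorant has to be integrable: a non-integrable left side
    would have integral 0 by default.\<close>
  proof (rule integral_mono')
    fix g assume "g \<in> space m"
    then have g: "g \<in> carrier K" by (simp add: space_haar)
    have "\<bar>translate K h \<phi> g - \<phi> g\<bar> \<le> d (inv h \<otimes> g) g"
      unfolding translate_def using lipschitz_1D[OF \<phi>] g h by simp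
    also have "\<dots> = d (inv h) \<one>"
      using right_invariant[of "inv h" \<one> g] g h by simp
    also have "\<dots> = d \<one> h"
      \<comment> \<open>A second right translation, now by \<open>h\<close>, carries the pair
        \<open>inv h\<close>, \<open>\<one>\<close> to \<open>\<one>\<close>,
        \<open>h\<close>.\<close>
      using right_invariant[of "inv h" \<one> h] h by simp
    finally show "\<bar>translate K h \<phi> g - \<phi> g\<bar> \<le> d \<one> h" .
  qed auto
  then show ?thesis by (simp add: variation_dist_def m.prob_space)
qed

lemma wasserstein_dist_lipschitz_density_le:
  assumes \<phi>: "\<phi> \<in> densities m" "\<phi> \<in> lipschitz_1 K d" and r: "0 < r"
  shows "wasserstein_dist K d (density m (\<lambda>g. ennreal (\<phi> g))) m \<le> wasserstein_modulus K d m r (r/2)"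
proof -
  \<comment> \<open>The kernel is constant, so any probability space can index it; \<open>m\<close>
    itself is at hand. Its total mass 1 collapses the integrals over the index.\<close>
  have "density_kernel m m (\<lambda>z. \<phi>)"
    using \<phi> m.prob_space_axioms by (auto simp: density_kernel_def densities_def)
  moreover have "kernel_v K d m m (\<lambda>z. \<phi>) r \<le> r/2"
    unfolding kernel_v_def
  proof (rule cSUP_least)
    show "met.mcball \<one> r \<noteq> {}"
      using met.centre_in_mcball_iff[of \<one> r] r by fastforce
  next
    fix h assume "h \<in> met.mcball \<one> r"
    then show "(\<integral>z. variation_dist m (translate K h \<phi>) \<phi> \<partial>m) \<le> r/2"
      using variation_dist_translate_le[OF \<phi>(2), of h] by (simp add: m.prob_space)
  qed
  ultimately have "kernel_w K d m m (\<lambda>z. \<phi>) \<le> wasserstein_modulus K d m r (r/2)"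
    by (rule kernel_w_le_wasserstein_modulus[OF measure_metric_group_axioms])
  then show ?thesis by (simp add: kernel_w_def m.prob_space)
qed

text \<open>Values in \<open>{0..1}\<close> force \<open>c \<le> 1\<close>, so
  \<open>1 + f - c\<close> is nonnegative and 1-Lipschitz without any rescaling of
  \<open>f\<close>.\<close>

lemma variance_lipschitz_1_le_wasserstein_modulus:
  assumes f: "f \<in> lipschitz_1 K d" and range: "\<And>x. x \<in> carrier K \<Longrightarrow> f x \<in> {0..1}" and r: "0 < r"
  shows "m.variance f \<le> wasserstein_modulus K d m r (r/2)"
proof -
  define c where "c = m.expectation f"
  define \<phi> where "\<phi> x = 1 + f x - c" for x
  note fi = lipschitz_1_integrable[OF f]
  have f2i: "integrable m (\<lambda>x. f x * f x)" by (rule lipschitz_1_mult_integrable[OF f fi])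
  have "c \<le> 1"
    unfolding c_def by (rule m.integral_le_const[OF fi]) (use range space_haar in auto)
  then have "AE x in m. 0 \<le> \<phi> x"
    using range by (intro AE_I2) (force simp: \<phi>_def space_haar)
  moreover have "integrable m \<phi>" "(\<integral>x. \<phi> x \<partial>m) = 1"
    using fi by (simp_all add: \<phi>_def[abs_def] m.prob_space c_def)
  ultimately have \<phi>d: "\<phi> \<in> densities m" by (simp add: densities_def)
  have \<phi>l: "\<phi> \<in> lipschitz_1 K d" using f by (simp add: lipschitz_1_def \<phi>_def)
  have "m.variance f = (\<integral>x. f x * f x \<partial>m) - c * c"
    using m.variance_eq[OF fi] f2i by (simp add: power2_eq_square c_def)
  \<comment> \<open>The integrand is \<open>\<phi> x * f x\<close> expanded; its linear part
    \<open>f x\<close> cancels against the mean subtracted at the end.\<close>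
  also have "\<dots> = (\<integral>x. (f x + f x * f x) - c * f x \<partial>m) - (\<integral>x. f x \<partial>m)"
    using fi f2i by (simp add: c_def)
  also have "\<dots> = (\<integral>x. \<phi> x * f x \<partial>m) - (\<integral>x. f x \<partial>m)"
    by (simp add: \<phi>_def algebra_simps)
  also have "\<dots> \<le> wasserstein_dist K d (density m (\<lambda>g. ennreal (\<phi> g))) m"
    using lipschitz_1_le_wasserstein_dist[OF f \<phi>d] by linarith
  also have "\<dots> \<le> wasserstein_modulus K d m r (r/2)"
    by (rule wasserstein_dist_lipschitz_density_le[OF \<phi>d \<phi>l r])
  finally show ?thesis .
qed

section \<open>Separating functions and the lower bound for the variance\<close>

lemma neighborhood_sets:
  assumes "A \<subseteq> carrier K"
  shows "neighborhood K d A \<epsilon> \<in> sets m"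
  unfolding neighborhood_def by (intro openin_imp_sets openin_Union) auto

lemma ex_lipschitz_1_separating:
  assumes A: "A \<subseteq> carrier K" "A \<noteq> {}" and \<epsilon>: "0 < \<epsilon>"
  obtains f where "f \<in> lipschitz_1 K d" "\<And>x. x \<in> carrier K \<Longrightarrow> f x \<in> {0..\<epsilon>}"
    "\<And>x. x \<in> A \<Longrightarrow> f x = 0" "\<And>x. x \<in> carrier K - neighborhood K d A \<epsilon> \<Longrightarrow> f x = \<epsilon>"
proof
  define D where "D x = (INF a\<in>A. d x a)" for x
  have bdd: "bdd_below (d x ` A)" for x by (rule bdd_belowI[of _ 0]) auto
  have nonneg: "0 \<le> D x" for x
    unfolding D_def by (rule cINF_greatest[OF A(2)]) auto
  have tri: "D x \<le> D y + d x y" if "x \<in> carrier K" "y \<in> carrier K" for x y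
  proof -
    have "D x - d x y \<le> D y"
      unfolding D_def[of y]
    proof (rule cINF_greatest[OF A(2)])
      fix a assume a: "a \<in> A"
      have "D x \<le> d x a" unfolding D_def by (rule cINF_lower[OF bdd a])
      also have "\<dots> \<le> d x y + d y a" using that a A by (intro met.triangle) auto
      finally show "D x - d x y \<le> d y a" by simp
    qed
    then show ?thesis by simp
  qed
  show "(\<lambda>x. min \<epsilon> (D x)) \<in> lipschitz_1 K d"
    unfolding lipschitz_1_def
  proof safe
    fix x y assume "x \<in> carrier K" "y \<in> carrier K"
    then show "\<bar>min \<epsilon> (D x) - min \<epsilon> (D y)\<bar> \<le> d x y"
      using tri[of x y] tri[of y x] met.commute[of x y] by (auto simp: min_def)
  qed
  show "min \<epsilon> (D x) \<in> {0..\<epsilon>}" for x using nonneg[of x] \<epsilon> by simp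
  show "min \<epsilon> (D x) = 0" if "x \<in> A" for x
  proof -
    have "D x \<le> d x x" unfolding D_def by (rule cINF_lower[OF bdd that])
    moreover have "d x x = 0" using that A by auto
    ultimately show ?thesis using nonneg[of x] \<epsilon> by simp
  qed
  \<comment> \<open>The neighbourhood is a union of open balls, so a point outside it is at distance
    at least \<open>\<epsilon>\<close> from every point of \<open>A\<close>.\<close>
  show "min \<epsilon> (D x) = \<epsilon>" if x: "x \<in> carrier K - neighborhood K d A \<epsilon>" for x
  proof -
    have "\<epsilon> \<le> D x"
      unfolding D_def
    proof (rule cINF_greatest[OF A(2)])
      fix a assume a: "a \<in> A"
      show "\<epsilon> \<le> d x a"
      proof (rule ccontr)
        assume "\<not> \<epsilon> \<le> d x a"
        then have "x \<in> met.mball a \<epsilon>" using a A x met.commute[of x a] by auto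
        with x a show False by (auto simp: neighborhood_def)
      qed
    qed
    then show ?thesis by simp
  qed
qed

text \<open>The variance is at least its contribution from \<open>A\<close> and \<open>B\<close>.
  The factor 3 comes from minimising \<open>c\<^sup>2/2 + (\<epsilon> - c)\<^sup>2\<close> over
  \<open>c\<close>: the minimum is \<open>\<epsilon>\<^sup>2/3\<close>, at
  \<open>c = 2 * \<epsilon> / 3\<close>.\<close>

lemma measure_neighborhood_ge:
  assumes A: "A \<in> sets m" "1/2 \<le> measure m A" and \<epsilon>: "0 < \<epsilon>" "\<epsilon> \<le> 1" and r: "0 < r"
  shows "\<epsilon>\<^sup>2 * (1 - measure m (neighborhood K d A \<epsilon>)) \<le> 3 * wasserstein_modulus K d m r (r/2)"
proof -
  have AK: "A \<subseteq> carrier K" using sets.sets_into_space[OF A(1)] by (simp add: space_haar)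
  have "A \<noteq> {}" using A(2) by auto
  then obtain f where f: "f \<in> lipschitz_1 K d" and f01: "\<And>x. x \<in> carrier K \<Longrightarrow> f x \<in> {0..\<epsilon>}"
    and fA: "\<And>x. x \<in> A \<Longrightarrow> f x = 0"
    and fB: "\<And>x. x \<in> carrier K - neighborhood K d A \<epsilon> \<Longrightarrow> f x = \<epsilon>"
    using ex_lipschitz_1_separating[OF AK _ \<epsilon>(1)] by blast
  define B where "B = space m - neighborhood K d A \<epsilon>"
  define c where "c = m.expectation f"
  note N = neighborhood_sets[OF AK, of \<epsilon>]
  have B: "B \<in> sets m" using N by (auto simp: B_def)
  have mB: "measure m B = 1 - measure m (neighborhood K d A \<epsilon>)"
    unfolding B_def by (rule m.prob_compl[OF N])
  have "c\<^sup>2 * measure m A + (\<epsilon> - c)\<^sup>2 * measure m B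
      = (\<integral>x. c\<^sup>2 * indicator A x + (\<epsilon> - c)\<^sup>2 * indicator B x \<partial>m)"
    using A(1) B by (simp add: m.emeasure_eq_measure)
  also have "\<dots> \<le> m.variance f"
    unfolding c_def[symmetric]
  proof (rule integral_mono)
    show "integrable m (\<lambda>x. (f x - c)\<^sup>2)"
      using lipschitz_1_mult_integrable[of "\<lambda>x. f x - c" "\<lambda>x. f x - c"] lipschitz_1_integrable[OF f] f
      by (simp add: power2_eq_square lipschitz_1_def)
    show "integrable m (\<lambda>x. c\<^sup>2 * indicator A x + (\<epsilon> - c)\<^sup>2 * indicator B x :: real)"
      using A(1) B by (intro Bochner_Integration.integrable_add integrable_mult_right)
        (auto simp: m.emeasure_eq_measure)
    \<comment> \<open>The two indicators never add up: a point in both sets would give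
      \<open>0 = f x = \<epsilon>\<close>.\<close>
    show "c\<^sup>2 * indicator A x + (\<epsilon> - c)\<^sup>2 * indicator B x \<le> (f x - c)\<^sup>2" if "x \<in> space m" for x
      using fA[of x] fB[of x] that \<epsilon>(1) by (auto simp: indicator_def B_def space_haar)
  qed
  \<comment> \<open>Here \<open>\<epsilon> \<le> 1\<close> puts the values of \<open>f\<close> into
    \<open>{0..1}\<close>.\<close>
  also have "\<dots> \<le> wasserstein_modulus K d m r (r/2)"
    using f01 \<epsilon> by (intro variance_lipschitz_1_le_wasserstein_modulus[OF f _ r]) force
  finally have var: "c\<^sup>2 * measure m A + (\<epsilon> - c)\<^sup>2 * measure m B \<le> wasserstein_modulus K d m r (r/2)" .
  \<comment> \<open>Half of this square is the difference of the two sides of the next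
    inequality.\<close>
  have "0 \<le> (3 * c - 2 * \<epsilon>)\<^sup>2" by simp
  then have "\<epsilon>\<^sup>2 \<le> 3 * (c\<^sup>2 * (1/2) + (\<epsilon> - c)\<^sup>2)"
    by (simp add: power2_eq_square algebra_simps)
  from mult_right_mono[OF this, of "measure m B"]
  have "\<epsilon>\<^sup>2 * measure m B \<le> 3 * (c\<^sup>2 * (1/2 * measure m B) + (\<epsilon> - c)\<^sup>2 * measure m B)"
    by (simp add: algebra_simps)
  \<comment> \<open>Since \<open>measure m B \<le> 1\<close>, half of it is at most
    \<open>1/2\<close>, hence at most \<open>measure m A\<close>.\<close>
  moreover have "c\<^sup>2 * (1/2 * measure m B) \<le> c\<^sup>2 * measure m A"
    using order_trans[OF _ A(2), of "1/2 * measure m B"] m.prob_le_1[of B]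
    by (intro mult_left_mono) simp_all
  ultimately show ?thesis using var mB by simp
qed

end

theorem proposition2p4:
  fixes K :: "('a, 'b) monoid_scheme" and d :: "'a \<Rightarrow> 'a \<Rightarrow> real" and m :: "'a measure"
    and \<epsilon> r :: real
  assumes "measure_metric_group K d m"
    and "0 < \<epsilon>" and "\<epsilon> \<le> 1" and "0 < r"
  shows "\<epsilon>\<^sup>2 * concentration_function K d m \<epsilon> \<le> 10 * wasserstein_modulus K d m r (r/2)"
proof -
  interpret measure_metric_group K d m by fact
  interpret m: prob_space m by (rule prob_space_haar)
  let ?W = "wasserstein_modulus K d m r (r/2)"
  note bound = measure_neighborhood_ge[OF _ _ assms(2-4)]
  have half: "1/2 \<le> measure m (space m)" by (simp add: m.prob_space)
  have "0 \<le> \<epsilon>\<^sup>2 * (1 - measure m (neighborhood K d (space m) \<epsilon>))" by simp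
  \<comment> \<open>Nonnegativity of the modulus, read off from the bound for the whole group, lets
    the constant 3 be relaxed to 10 at the end.\<close>
  with bound[OF sets.top half] have W: "0 \<le> ?W" by linarith
  have "1 - 3 * ?W / \<epsilon>\<^sup>2 \<le>
      Inf {measure m (neighborhood K d A \<epsilon>) | A. A \<in> sets m \<and> measure m A \<ge> 1/2}"
  proof (rule cInf_greatest)
    show "{measure m (neighborhood K d A \<epsilon>) | A. A \<in> sets m \<and> measure m A \<ge> 1/2} \<noteq> {}"
      using half by blast
  next
    fix t assume "t \<in> {measure m (neighborhood K d A \<epsilon>) | A. A \<in> sets m \<and> measure m A \<ge> 1/2}"
    then have "\<epsilon>\<^sup>2 * (1 - t) \<le> 3 * ?W" using bound by auto
    then show "1 - 3 * ?W / \<epsilon>\<^sup>2 \<le> t" using assms(2) by (simp add: field_simps)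
  qed
  then have "\<epsilon>\<^sup>2 * concentration_function K d m \<epsilon> \<le> 3 * ?W"
    unfolding concentration_function_def using assms(2) by (simp add: field_simps)
  with W show ?thesis by simp
qed

end
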